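(* Let $S\subset\mathbb{R}^d$ be a compact set with $\mu_d(S)>0$ and $\mu_d(\partial S)=0$, and let $X_1,X_2,\dots$ be iid random vectors uniformly distributed on $S$. Put $\aleph_n=\{X_1,\dots,X_n\}$. Let $\varepsilon_n\to 0$ be a sequence of positive real numbers and let $S_n=B(\aleph_n,\varepsilon_n)=\bigcup_{i=1}^n B(X_i,\varepsilon_n)$. Assume that $(\varepsilon_n)$ is such that, with probability one, $S\subset S_n$ for all $n$ large enough. For each $n$, let $(Z_{11},Z_{12}),(Z_{21},Z_{22}),\dots$ be pairs of random vectors that, given $\aleph_n$, are independent and uniformly distributed on $S_n\times S_n$. Then $\hat{\mathcal{W}}_m(S_n)\to\mathcal{W}(S)$ in the following sense: with probability one, $$\lim_{n\to\infty}\lim_{m\to\infty}\frac{1}{m}\sum_{j=1}^m \mathbb{I}_{\{(Z_{j1}+Z_{j2})/2\in S_n\}}=\mathbb{P}\big((X_1+X_2)/2\in S\big).$$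
   Context: $\mu_d$ is Lebesgue measure on $\mathbb{R}^d$, $\partial S$ is the topological boundary of $S$, $B(x,\varepsilon)$ is the closed Euclidean ball of radius $\varepsilon$ centered at $x$, and $\mathbb{I}$ denotes the indicator function. The measure of non-convexity $\mathcal{W}$ and its estimator are $$\mathcal{W}(S)=1-\mathbb{P}\big((X_1+X_2)/2\in S\big),\qquad \hat{\mathcal{W}}_m(S_n)=1-\frac1m\sum_{j=1}^m\mathbb{I}_{\{(Z_{j1}+Z_{j2})/2\in S_n\}},$$ where $X_1,X_2$ are iid uniformly distributed on $S$. The pairs $(Z_{j1},Z_{j2})$ depend on $n$ through $S_n$. *)

theory Defs
  imports "HOL-Probability.Probability"
begin

definition thickening :: "(real ^ 'd) set \<Rightarrow> real \<Rightarrow> (real ^ 'd) set" where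
  "thickening A e = (\<Union>x\<in>A. cball x e)"

text \<open>Indices of samples start at 1, as do the indices of the simulated pairs below.\<close>

definition sample :: "(nat \<Rightarrow> 'w \<Rightarrow> real ^ 'd) \<Rightarrow> nat \<Rightarrow> 'w \<Rightarrow> (real ^ 'd) set" where
  "sample X n \<omega> = (\<lambda>i. X i \<omega>) ` {1..n}"

text \<open>The \<open>\<sigma>\<close>-algebra generated by the random vector \<open>(X 1, \<dots>, X n)\<close>; conditioning on
  the sample means conditioning on it.\<close>

definition sample_algebra ::
    "'w measure \<Rightarrow> (nat \<Rightarrow> 'w \<Rightarrow> real ^ 'd) \<Rightarrow> nat \<Rightarrow> 'w measure" where
  "sample_algebra M X n =
     vimage_algebra (space M) (\<lambda>\<omega>. \<lambda>i\<in>{1..n}. X i \<omega>) (Pi\<^sub>M {1..n} (\<lambda>_. borel))"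

definition cond_probability :: "'w measure \<Rightarrow> 'w measure \<Rightarrow> 'w set \<Rightarrow> 'w \<Rightarrow> real" where
  "cond_probability M F E = real_cond_exp M F (indicator E)"

definition cond_indep_vars ::
    "'w measure \<Rightarrow> 'w measure \<Rightarrow> 'b measure \<Rightarrow> ('i \<Rightarrow> 'w \<Rightarrow> 'b) \<Rightarrow> 'i set \<Rightarrow> bool" where
  "cond_indep_vars M F N Z I \<longleftrightarrow>
     (\<forall>i\<in>I. Z i \<in> M \<rightarrow>\<^sub>M N) \<and>
     (\<forall>J A. J \<subseteq> I \<longrightarrow> finite J \<longrightarrow> J \<noteq> {} \<longrightarrow> (\<forall>j\<in>J. A j \<in> sets N) \<longrightarrow>
        (AE \<omega> in M. cond_probability M F (\<Inter>j\<in>J. Z j -` A j \<inter> space M) \<omega> =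
                     (\<Prod>j\<in>J. cond_probability M F (Z j -` A j \<inter> space M) \<omega>)))"

text \<open>\<open>K \<omega>\<close> is the conditional law of \<open>Z\<close> given \<open>F\<close>.\<close>

definition has_cond_distr ::
    "'w measure \<Rightarrow> 'w measure \<Rightarrow> 'b measure \<Rightarrow> ('w \<Rightarrow> 'b) \<Rightarrow> ('w \<Rightarrow> 'b measure) \<Rightarrow> bool" where
  "has_cond_distr M F N Z K \<longleftrightarrow>
     Z \<in> M \<rightarrow>\<^sub>M N \<and>
     (\<forall>A\<in>sets N. AE \<omega> in M. cond_probability M F (Z -` A \<inter> space M) \<omega> = measure (K \<omega>) A)"

text \<open>The pair \<open>(x, y)\<close> below is a pair of independent uniform points of \<open>S\<close>, realised on the
  product space.\<close>

definition nonconvexity :: "(real ^ 'd) set \<Rightarrow> real" where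
  "nonconvexity S = 1 - measure (uniform_measure lborel S \<Otimes>\<^sub>M uniform_measure lborel S)
                           {(x, y). (1 / 2) *\<^sub>R (x + y) \<in> S}"

definition midpoint_freq ::
    "nat \<Rightarrow> (real ^ 'd) set \<Rightarrow> (nat \<Rightarrow> (real ^ 'd) \<times> (real ^ 'd)) \<Rightarrow> real" where
  "midpoint_freq m T z =
     1 / real m * (\<Sum>j=1..m. indicator T ((1 / 2) *\<^sub>R (fst (z j) + snd (z j))))"

definition nonconvexity_est ::
    "nat \<Rightarrow> (real ^ 'd) set \<Rightarrow> (nat \<Rightarrow> (real ^ 'd) \<times> (real ^ 'd)) \<Rightarrow> real" where
  "nonconvexity_est m T z = 1 - midpoint_freq m T z"

text \<open>\<open>lim n. lim m. a n m = l\<close>, where every inner limit (for \<open>n \<ge> 1\<close>) is required to exist.\<close>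

definition iterated_limit :: "(nat \<Rightarrow> nat \<Rightarrow> real) \<Rightarrow> real \<Rightarrow> bool" where
  "iterated_limit a l \<longleftrightarrow>
     (\<exists>L. (\<forall>n\<ge>1. (\<lambda>m. a n m) \<longlonglongrightarrow> L n) \<and> L \<longlonglongrightarrow> l)"

end

theory Submission
  imports Defs "HOL-Library.Discrete_Functions"
begin

text \<open>For fixed \<open>n\<close>, the centred indicators \<open>1{(Z\<^sub>j\<^sub>1 + Z\<^sub>j\<^sub>2)/2 \<in> S\<^sub>n} - p\<^sub>n\<close>, where \<open>p\<^sub>n\<close> is the conditional
  probability of the midpoint event given the sample, are bounded and, by conditional
  independence, pairwise orthogonal in \<open>L\<^sup>2\<close>. A strong law for bounded orthogonal variables
  (Chebyshev along the squares, then interpolation) therefore identifies the inner limit as \<open>p\<^sub>n\<close>.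
  Almost surely \<open>S \<subseteq> S\<^sub>n \<subseteq> B(S, \<epsilon>\<^sub>n)\<close> eventually, and \<open>S\<close> is closed, so the indicator of \<open>S\<^sub>n\<close>
  converges pointwise to that of \<open>S\<close>; dominated convergence gives the outer limit.\<close>

section \<open>Strong law for bounded orthogonal variables\<close>

text \<open>Orthogonality makes the second moment of the \<open>m\<close>-th partial sum at most
  \<open>m * C^2\<close>. Along \<open>m = k^2\<close> the squared averages then have expectations
  at most \<open>C^2 / k^2\<close>, which are summable, so these averages tend to 0 almost surely.
  Boundedness controls the partial sums between consecutive squares.\<close>

lemma (in prob_space) bounded_orthogonal_slln:
  fixes D :: "nat \<Rightarrow> 'a \<Rightarrow> real"
  assumes meas [measurable]: "\<And>j. j \<ge> 1 \<Longrightarrow> D j \<in> borel_measurable M"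
    and bound: "\<And>j \<omega>. j \<ge> 1 \<Longrightarrow> \<omega> \<in> space M \<Longrightarrow> \<bar>D j \<omega>\<bar> \<le> C"
    and orth: "\<And>i j. i \<ge> 1 \<Longrightarrow> j \<ge> 1 \<Longrightarrow> i \<noteq> j \<Longrightarrow> expectation (\<lambda>\<omega>. D i \<omega> * D j \<omega>) = 0"
  shows "AE \<omega> in M. (\<lambda>m. (\<Sum>j=1..m. D j \<omega>) / real m) \<longlonglongrightarrow> 0"
proof -
  define T where "T m \<omega> = (\<Sum>j=1..m. D j \<omega>)" for m \<omega>
  have T_meas [measurable]: "T m \<in> borel_measurable M" for m
    unfolding T_def by (intro borel_measurable_sum meas) auto
  \<comment> \<open>A point of the space gives
    \<open>0 \<le> \<bar>D 1 \<omega>0\<bar> \<le> C\<close>, so the sign of \<open>C\<close> comes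
    from the bound itself.\<close>
  have "space M \<noteq> {}" by (rule not_empty)
  then obtain \<omega>0 where "\<omega>0 \<in> space M" by auto
  then have C0: "C \<ge> 0" using bound[of 1 \<omega>0] by linarith
  have prod_bound: "\<bar>D i \<omega> * D j \<omega>\<bar> \<le> C * C"
    if "i \<ge> 1" "j \<ge> 1" "\<omega> \<in> space M" for i j \<omega>
    unfolding abs_mult using bound that C0 by (intro mult_mono) auto
  have int: "integrable M (\<lambda>\<omega>. D i \<omega> * D j \<omega>)" if "i \<ge> 1" "j \<ge> 1" for i j
    using that prod_bound
    by (intro integrable_const_bound[where B="C * C"] borel_measurable_times meas) auto
  have sq: "(T m \<omega>)\<^sup>2 = (\<Sum>i=1..m. \<Sum>j=1..m. D i \<omega> * D j \<omega>)" for m \<omega>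
    by (simp add: T_def power2_eq_square sum_product)
  have int2: "integrable M (\<lambda>\<omega>. (T m \<omega>)\<^sup>2)" for m
    unfolding sq by (intro Bochner_Integration.integrable_sum int) auto
  have second_moment: "expectation (\<lambda>\<omega>. (T m \<omega>)\<^sup>2) \<le> real m * (C * C)" for m
  proof -
    have "expectation (\<lambda>\<omega>. (T m \<omega>)\<^sup>2)
        = (\<Sum>i=1..m. \<Sum>j=1..m. expectation (\<lambda>\<omega>. D i \<omega> * D j \<omega>))"
      unfolding sq by (subst Bochner_Integration.integral_sum;
          (intro Bochner_Integration.integrable_sum int sum.cong refl Bochner_Integration.integral_sum)?) auto
    \<comment> \<open>By orthogonality only the \<open>m\<close> diagonal terms survive, each at
      most \<open>C * C\<close>.\<close>
    also have "\<dots> = (\<Sum>i=1..m. \<Sum>j=1..m. if i = j then expectation (\<lambda>\<omega>. D i \<omega> * D i \<omega>) else 0)"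
      by (intro sum.cong refl) (auto simp: orth)
    also have "\<dots> = (\<Sum>i=1..m. expectation (\<lambda>\<omega>. D i \<omega> * D i \<omega>))"
      by (intro sum.cong refl) auto
    also have "\<dots> \<le> (\<Sum>i=1..m. C * C)"
    proof (intro sum_mono)
      fix i assume i: "i \<in> {1..m}"
      have "AE \<omega> in M. D i \<omega> * D i \<omega> \<le> C * C"
        using i prod_bound[of i i] by (intro AE_I2) (simp add: abs_le_iff)
      then show "expectation (\<lambda>\<omega>. D i \<omega> * D i \<omega>) \<le> C * C"
        using i by (intro integral_le_const int) auto
    qed
    finally show ?thesis by simp
  qed
  \<comment> \<open>\<open>q k\<close> is the squared average at time \<open>k^2\<close>. For
    \<open>k = 0\<close> division by zero makes it 0, in agreement with \<open>inverse 0 = 0\<close>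
    in the bound below.\<close>
  define q where "q k \<omega> = (T (k\<^sup>2) \<omega> / (real k)\<^sup>2)\<^sup>2" for k \<omega>
  have q_meas [measurable]: "q k \<in> borel_measurable M" for k
    unfolding q_def by measurable
  have q_int: "(\<integral>\<^sup>+\<omega>. ennreal (q k \<omega>) \<partial>M) \<le> ennreal (C * C * inverse ((real k)\<^sup>2))" for k
  proof -
    have eq: "q k \<omega> = (T (k\<^sup>2) \<omega>)\<^sup>2 * inverse ((real k)\<^sup>2 * (real k)\<^sup>2)" for \<omega>
      by (simp add: q_def power_divide divide_inverse power2_eq_square)
    have "(\<integral>\<^sup>+\<omega>. ennreal (q k \<omega>) \<partial>M) = ennreal (expectation (q k))"
      using int2[of "k\<^sup>2"] by (intro nn_integral_eq_integral) (auto simp: eq)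
    also have "expectation (q k) = expectation (\<lambda>\<omega>. (T (k\<^sup>2) \<omega>)\<^sup>2) * inverse ((real k)\<^sup>2 * (real k)\<^sup>2)"
      unfolding eq by simp
    also have "\<dots> \<le> (real (k\<^sup>2) * (C * C)) * inverse ((real k)\<^sup>2 * (real k)\<^sup>2)"
      by (intro mult_right_mono second_moment) auto
    also have "\<dots> = C * C * inverse ((real k)\<^sup>2)"
      by (cases "k = 0") (auto simp: field_simps)
    finally show ?thesis by (simp add: ennreal_leI)
  qed
  \<comment> \<open>The expected sum of all \<open>q k\<close> is finite, so the sum is finite
    almost surely and its terms tend to 0.\<close>
  have "(\<integral>\<^sup>+\<omega>. (\<Sum>k. ennreal (q k \<omega>)) \<partial>M) = (\<Sum>k. \<integral>\<^sup>+\<omega>. ennreal (q k \<omega>) \<partial>M)"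
    by (rule nn_integral_suminf) auto
  also have "\<dots> \<le> (\<Sum>k. ennreal (C * C * inverse ((real k)\<^sup>2)))"
    by (intro suminf_le q_int) auto
  also have "\<dots> < \<infinity>"
  proof -
    have "summable (\<lambda>k. C * C * inverse ((real k)\<^sup>2))"
      by (intro summable_mult inverse_power_summable) auto
    then show ?thesis
      by (subst suminf_ennreal2) auto
  qed
  finally have "AE \<omega> in M. (\<Sum>k. ennreal (q k \<omega>)) \<noteq> \<infinity>"
    by (intro nn_integral_noteq_infinite) auto
  then show ?thesis
  proof (rule AE_mp, intro AE_I2 impI)
    fix \<omega> assume \<omega>: "\<omega> \<in> space M" and fin: "(\<Sum>k. ennreal (q k \<omega>)) \<noteq> \<infinity>"
    have "summable (\<lambda>k. q k \<omega>)"
      using fin by (intro summable_suminf_not_top) (auto simp: q_def)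
    then have "(\<lambda>k. q k \<omega>) \<longlonglongrightarrow> 0" by (rule summable_LIMSEQ_zero)
    then have "(\<lambda>k. sqrt (q k \<omega>)) \<longlonglongrightarrow> 0"
      using tendsto_real_sqrt by fastforce
    \<comment> \<open>The second summand is the interpolation error \<open>2 k C / k^2\<close>; the
      first is the absolute average at \<open>k^2\<close>.\<close>
    then have "(\<lambda>k. sqrt (q k \<omega>) + 2 * C * (1 / real k)) \<longlonglongrightarrow> 0 + 2 * C * 0"
      by (intro tendsto_intros lim_1_over_n)
    moreover have "filterlim floor_sqrt at_top at_top"
      unfolding filterlim_at_top eventually_at_top_linorder
      by (metis le_floor_sqrtI)
    ultimately have lim: "(\<lambda>m. sqrt (q (floor_sqrt m) \<omega>) + 2 * C * (1 / real (floor_sqrt m))) \<longlonglongrightarrow> 0"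
      by (auto intro: filterlim_compose)
    \<comment> \<open>for \<open>k\<^sup>2 \<le> m < (k + 1)\<^sup>2\<close>, \<open>T m\<close> differs from \<open>T (k\<^sup>2)\<close> by at most \<open>2 k C\<close>\<close>
    have "\<bar>T m \<omega> / real m\<bar> \<le> sqrt (q (floor_sqrt m) \<omega>) + 2 * C * (1 / real (floor_sqrt m))"
      if m: "m \<ge> 1" for m
    proof -
      define k where "k = floor_sqrt m"
      have k: "k \<ge> 1" "k\<^sup>2 \<le> m" "m < (Suc k)\<^sup>2"
        using m Suc_floor_sqrt_power2_gt[of m] by (auto simp: k_def Suc_le_eq)
      have "{1..m} = {1..k\<^sup>2} \<union> {k\<^sup>2<..m}" using k by auto
      then have "T m \<omega> = T (k\<^sup>2) \<omega> + (\<Sum>j\<in>{k\<^sup>2<..m}. D j \<omega>)"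
        unfolding T_def by (simp only:) (rule sum.union_disjoint; auto)
      moreover have "\<bar>\<Sum>j\<in>{k\<^sup>2<..m}. D j \<omega>\<bar> \<le> (\<Sum>j\<in>{k\<^sup>2<..m}. C)"
        using bound \<omega> by (intro order_trans[OF sum_abs] sum_mono) auto
      moreover have "(\<Sum>j\<in>{k\<^sup>2<..m}. C) \<le> 2 * real k * C"
      proof -
        have "m - k\<^sup>2 \<le> 2 * k" using k by (simp add: power2_eq_square)
        then have "real (m - k\<^sup>2) \<le> 2 * real k" by linarith
        then show ?thesis using C0 by (simp add: mult_right_mono)
      qed
      ultimately have le: "\<bar>T m \<omega>\<bar> \<le> \<bar>T (k\<^sup>2) \<omega>\<bar> + 2 * real k * C" by linarith
      have km: "(real k)\<^sup>2 \<le> real m" using k by (metis of_nat_le_iff of_nat_power)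
      have kpos: "(real k)\<^sup>2 > 0" using k by simp
      have "\<bar>T m \<omega> / real m\<bar> \<le> (\<bar>T (k\<^sup>2) \<omega>\<bar> + 2 * real k * C) / real m"
        using le by (simp add: divide_right_mono)
      also have "\<dots> \<le> (\<bar>T (k\<^sup>2) \<omega>\<bar> + 2 * real k * C) / (real k)\<^sup>2"
        using km kpos C0 m by (intro divide_left_mono) auto
      also have "\<dots> = sqrt (q k \<omega>) + 2 * C * (1 / real k)"
        using k unfolding q_def real_sqrt_abs add_divide_distrib abs_divide
        by (simp add: power2_eq_square)
      finally show ?thesis unfolding k_def .
    qed
    then have "eventually (\<lambda>m. norm (T m \<omega> / real m) \<le>
        sqrt (q (floor_sqrt m) \<omega>) + 2 * C * (1 / real (floor_sqrt m))) sequentially"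
      unfolding eventually_sequentially by (intro exI[of _ 1]) simp
    from this lim show "(\<lambda>m. (\<Sum>j=1..m. D j \<omega>) / real m) \<longlonglongrightarrow> 0"
      unfolding T_def[symmetric] by (rule Lim_null_comparison)
  qed
qed

section \<open>Joint laws from conditional distributions\<close>

text \<open>The conditional law need only be known on a generator \<open>G\<close>: for pairs of conditionally
  independent variables it is given on measurable rectangles.\<close>

lemma (in prob_space) joint_law_eq_bind:
  assumes sub: "subalgebra M F"
    and Z [measurable]: "Z \<in> M \<rightarrow>\<^sub>M N"
    and Q: "Q \<in> F \<rightarrow>\<^sub>M prob_algebra N"
    and G: "sets N = sigma_sets (space N) G" "Int_stable G" "space N \<in> G"
    and cond: "\<And>A. A \<in> G \<Longrightarrow>
      AE \<omega> in M. cond_probability M F (Z -` A \<inter> space M) \<omega> = measure (Q \<omega>) A"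
  shows "distr M (F \<Otimes>\<^sub>M N) (\<lambda>\<omega>. (\<omega>, Z \<omega>))
    = restr_to_subalg M F \<bind> (\<lambda>\<omega>. distr (Q \<omega>) (F \<Otimes>\<^sub>M N) (Pair \<omega>))" (is "?L = ?B")
proof -
  interpret sigma_finite_subalgebra M F
    by (intro finite_measure_subalgebra_is_sigma_finite finite_measure_subalgebra.intro
        finite_measure_subalgebra_axioms.intro sub finite_measure_axioms)
  note [measurable] = Q
  have sets_R [measurable_cong]: "sets (restr_to_subalg M F) = sets F"
    by (rule sets_restr_to_subalg[OF sub])
  have spF: "space F = space M" using sub by (simp add: subalgebra_def)
  have Qprob: "prob_space (Q \<omega>)" "sets (Q \<omega>) = sets N" if "\<omega> \<in> space M" for \<omega>
    using measurable_space[OF Q, of \<omega>] that spF by (auto simp: space_prob_algebra)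
  have pair_meas [measurable]: "(\<lambda>\<omega>. (\<omega>, Z \<omega>)) \<in> M \<rightarrow>\<^sub>M F \<Otimes>\<^sub>M N"
    using measurable_from_subalg[OF sub, of "\<lambda>x. x" F] by (intro measurable_Pair) auto
  have ker: "(\<lambda>\<omega>. distr (Q \<omega>) (F \<Otimes>\<^sub>M N) (Pair \<omega>))
      \<in> restr_to_subalg M F \<rightarrow>\<^sub>M subprob_algebra (F \<Otimes>\<^sub>M N)"
    by (intro measurable_prob_algebraD measurable_in_subalg[OF sub] measurable_distr_prob_space2[OF Q])
      simp
  have ne: "space (restr_to_subalg M F) \<noteq> {}"
    by (simp add: space_restr_to_subalg not_empty)
  have Gsets: "G \<subseteq> sets N"
    by (subst G(1)) (blast intro: sigma_sets.Basic)
  have Gpow: "G \<subseteq> Pow (space N)"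
    using Gsets sets.space_closed by (rule order_trans)
  \<comment> \<open>These rectangles are stable under intersection and generate the product. Since
    \<open>space N\<close> lies in \<open>G\<close>, the full space is itself a rectangle, so a
    constant sequence serves as the exhaustion.\<close>
  let ?E = "{B \<times> A | B A. B \<in> sets F \<and> A \<in> G}"
  have gen: "sets (F \<Otimes>\<^sub>M N) = sigma_sets (space F \<times> space N) ?E"
  proof -
    have "sets (F \<Otimes>\<^sub>M N) = sets (sigma (space F \<times> space N) ?E)"
      using Gpow sets.space_closed[of F]
      by (intro sets_pair_eq[where Ca="{space F}" and Cb="{space N}"])
         (use G sets.sigma_sets_eq[of F] in auto)
    also have "\<dots> = sigma_sets (space F \<times> space N) ?E"
      using Gpow sets.sets_into_space by (intro sets_measure_of) fast
    finally show ?thesis .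
  qed
  show ?thesis
  proof (rule measure_eqI_generator_eq[where E="?E" and A="\<lambda>_. space F \<times> space N"])
    show "Int_stable ?E"
      using G(2) by (auto simp: Int_stable_def Times_Int_Times) (metis sets.Int)
    show "?E \<subseteq> Pow (space F \<times> space N)"
      using Gpow sets.sets_into_space by fast
    show "sets ?L = sigma_sets (space F \<times> space N) ?E"
      using gen by simp
    show "sets ?B = sigma_sets (space F \<times> space N) ?E"
      unfolding gen[symmetric] by (rule sets_bind[OF _ ne]) (rule sets_distr)
    show "range (\<lambda>_. space F \<times> space N) \<subseteq> ?E" using G(3) by blast
    show "emeasure ?L (space F \<times> space N) \<noteq> \<infinity>"
      using prob_space.emeasure_space_1[OF prob_space_distr[OF pair_meas]]
      by (simp add: space_pair_measure)
    fix Y assume "Y \<in> ?E"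
    then obtain B A where Y: "Y = B \<times> A" and B [measurable]: "B \<in> sets F" and A: "A \<in> G" by blast
    have AN [measurable]: "A \<in> sets N" using A Gsets by blast
    have BM [measurable]: "B \<in> sets M" using sub B by (auto simp: subalgebra_def)
    have BsM: "B \<subseteq> space M" using BM by (rule sets.sets_into_space)
    let ?C = "Z -` A \<inter> space M"
    have C [measurable]: "?C \<in> sets M" by measurable
    have QA [measurable]: "(\<lambda>\<omega>. emeasure (Q \<omega>) A) \<in> borel_measurable F"
      using measurable_emeasure_kernel[OF measurable_prob_algebraD[OF Q] AN] .
    have QA': "(\<lambda>\<omega>. measure (Q \<omega>) A) \<in> borel_measurable F"
      unfolding measure_def by measurable
    have QAM [measurable]: "(\<lambda>\<omega>. measure (Q \<omega>) A) \<in> borel_measurable M"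
      by (rule measurable_from_subalg[OF sub QA'])
    \<comment> \<open>On \<open>B \<times> A\<close> the mixture has mass
      \<open>E[1_B * Q(A)]\<close>. This is rewritten below, by way of the conditional expectation
      of \<open>?C\<close>, into the probability of \<open>B \<inter> ?C\<close>.\<close>
    have "emeasure ?B Y = (\<integral>\<^sup>+\<omega>. emeasure (distr (Q \<omega>) (F \<Otimes>\<^sub>M N) (Pair \<omega>)) Y \<partial>restr_to_subalg M F)"
      unfolding Y by (rule emeasure_bind[OF ne ker]) measurable
    also have "\<dots> = (\<integral>\<^sup>+\<omega>. indicator B \<omega> * emeasure (Q \<omega>) A \<partial>restr_to_subalg M F)"
    proof (rule nn_integral_cong)
      fix \<omega> assume "\<omega> \<in> space (restr_to_subalg M F)"
      then have \<omega>: "\<omega> \<in> space M" by (simp add: space_restr_to_subalg)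
      have [measurable_cong]: "sets (Q \<omega>) = sets N" using Qprob[OF \<omega>] by simp
      have "emeasure (distr (Q \<omega>) (F \<Otimes>\<^sub>M N) (Pair \<omega>)) Y = emeasure (Q \<omega>) (Pair \<omega> -` Y \<inter> space (Q \<omega>))"
        using \<omega> spF unfolding Y by (intro emeasure_distr) auto
      also have "Pair \<omega> -` Y \<inter> space (Q \<omega>) = (if \<omega> \<in> B then A else {})"
        using sets.sets_into_space[OF AN] sets_eq_imp_space_eq[OF Qprob(2)[OF \<omega>]] by (auto simp: Y)
      finally show "emeasure (distr (Q \<omega>) (F \<Otimes>\<^sub>M N) (Pair \<omega>)) Y = indicator B \<omega> * emeasure (Q \<omega>) A"
        by simp
    qed
    also have "\<dots> = (\<integral>\<^sup>+\<omega>. indicator B \<omega> * emeasure (Q \<omega>) A \<partial>M)"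
      by (rule nn_integral_subalgebra2[OF sub]) measurable
    also have "\<dots> = (\<integral>\<^sup>+\<omega>. ennreal (indicator B \<omega> * measure (Q \<omega>) A) \<partial>M)"
    proof (rule nn_integral_cong)
      fix \<omega> assume \<omega>: "\<omega> \<in> space M"
      interpret Q: prob_space "Q \<omega>" by (rule Qprob[OF \<omega>])
      show "indicator B \<omega> * emeasure (Q \<omega>) A = ennreal (indicator B \<omega> * measure (Q \<omega>) A)"
        by (simp add: Q.emeasure_eq_measure indicator_def)
    qed
    also have "\<dots> = ennreal (\<integral>\<omega>. indicator B \<omega> * measure (Q \<omega>) A \<partial>M)"
    proof (rule nn_integral_eq_integral)
      show "integrable M (\<lambda>\<omega>. indicator B \<omega> * measure (Q \<omega>) A)"
        using Qprob(1)[THEN prob_space.prob_le_1]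
        by (intro integrable_const_bound[where B=1] AE_I2) (simp_all add: indicator_def)
    qed simp
    \<comment> \<open>The hypothesis on \<open>G\<close> enters here; the next step is the averaging
      property of conditional expectation over the set \<open>B\<close> of \<open>F\<close>.\<close>
    also have "(\<integral>\<omega>. indicator B \<omega> * measure (Q \<omega>) A \<partial>M)
        = (\<integral>\<omega>. indicator B \<omega> * real_cond_exp M F (indicator ?C) \<omega> \<partial>M)"
      using cond[OF A] unfolding cond_probability_def
      by (intro integral_cong_AE) auto
    also have "\<dots> = (\<integral>\<omega>. indicator B \<omega> * indicator ?C \<omega> \<partial>M)"
      by (rule real_cond_exp_intg(2))
         (auto intro!: integrable_const_bound[where B=1] simp: indicator_def)
    also have "\<dots> = measure M (B \<inter> ?C)"
      using BsM by (simp add: indicator_inter_arith[symmetric] Int_absorb2 Int_assoc)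
    also have "ennreal \<dots> = emeasure M (B \<inter> ?C)" by (simp add: emeasure_eq_measure)
    also have "B \<inter> ?C = (\<lambda>\<omega>. (\<omega>, Z \<omega>)) -` Y \<inter> space M" using BsM by (auto simp: Y)
    also have "emeasure M \<dots> = emeasure ?L Y"
      unfolding Y by (rule emeasure_distr[symmetric]) measurable
    finally show "emeasure ?L Y = emeasure ?B Y" by simp
  qed simp
qed

text \<open>Integrating \<open>f\<close> against the joint law of \<omega> and
  \<open>Z \<omega>\<close>, and disintegrating that law along \<open>Q\<close>, gives the identity.
  The integrand may depend on \<omega> too, as long as it does so measurably for \<open>F\<close>;
  this is essential for sets built from the sample.\<close>

lemma (in prob_space) cond_law_integral:
  fixes f :: "'a \<times> 'b \<Rightarrow> real"
  assumes sub: "subalgebra M F"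
    and Z [measurable]: "Z \<in> M \<rightarrow>\<^sub>M N"
    and Q: "Q \<in> F \<rightarrow>\<^sub>M prob_algebra N"
    and G: "sets N = sigma_sets (space N) G" "Int_stable G" "space N \<in> G"
    and cond: "\<And>A. A \<in> G \<Longrightarrow>
      AE \<omega> in M. cond_probability M F (Z -` A \<inter> space M) \<omega> = measure (Q \<omega>) A"
    and f [measurable]: "f \<in> borel_measurable (F \<Otimes>\<^sub>M N)"
    and f_bound: "\<And>x. x \<in> space (F \<Otimes>\<^sub>M N) \<Longrightarrow> \<bar>f x\<bar> \<le> C"
  shows "expectation (\<lambda>\<omega>. f (\<omega>, Z \<omega>)) = expectation (\<lambda>\<omega>. \<integral>z. f (\<omega>, z) \<partial>Q \<omega>)"
proof -
  note [measurable] = Q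
  have sets_R [measurable_cong]: "sets (restr_to_subalg M F) = sets F"
    by (rule sets_restr_to_subalg[OF sub])
  have spF: "space F = space M" using sub by (simp add: subalgebra_def)
  have Qprob: "prob_space (Q \<omega>)" "sets (Q \<omega>) = sets N" if "\<omega> \<in> space M" for \<omega>
    using measurable_space[OF Q, of \<omega>] that spF by (auto simp: space_prob_algebra)
  have pair_meas [measurable]: "(\<lambda>\<omega>. (\<omega>, Z \<omega>)) \<in> M \<rightarrow>\<^sub>M F \<Otimes>\<^sub>M N"
    using measurable_from_subalg[OF sub, of "\<lambda>x. x" F] by (intro measurable_Pair) auto
  have ker: "(\<lambda>\<omega>. distr (Q \<omega>) (F \<Otimes>\<^sub>M N) (Pair \<omega>))
      \<in> F \<rightarrow>\<^sub>M prob_algebra (F \<Otimes>\<^sub>M N)"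
    by (intro measurable_distr_prob_space2[OF Q]) simp
  have joint_law: "distr M (F \<Otimes>\<^sub>M N) (\<lambda>\<omega>. (\<omega>, Z \<omega>))
      = restr_to_subalg M F \<bind> (\<lambda>\<omega>. distr (Q \<omega>) (F \<Otimes>\<^sub>M N) (Pair \<omega>))"
    by (rule joint_law_eq_bind[OF sub Z Q G cond])
  have ker_prob: "prob_space (distr (Q \<omega>) (F \<Otimes>\<^sub>M N) (Pair \<omega>))" if "\<omega> \<in> space M" for \<omega>
    using measurable_space[OF ker, of \<omega>] that spF by (simp add: space_prob_algebra)
  have inner: "integral\<^sup>L (distr (Q \<omega>) (F \<Otimes>\<^sub>M N) (Pair \<omega>)) f = (\<integral>z. f (\<omega>, z) \<partial>Q \<omega>)"
    if "\<omega> \<in> space M" for \<omega>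
  proof -
    have [measurable_cong]: "sets (Q \<omega>) = sets N" using Qprob[OF that] by simp
    show ?thesis using that spF by (intro integral_distr) auto
  qed
  \<comment> \<open>Measurability with respect to \<open>F\<close> is what permits replacing the
    restricted measure by \<open>M\<close> at the end.\<close>
  have meas: "(\<lambda>\<omega>. integral\<^sup>L (distr (Q \<omega>) (F \<Otimes>\<^sub>M N) (Pair \<omega>)) f) \<in> borel_measurable F"
    by (rule measurable_compose[OF measurable_prob_algebraD[OF ker]
          integral_measurable_subprob_algebra[OF f]])
  have "expectation (\<lambda>\<omega>. f (\<omega>, Z \<omega>)) = integral\<^sup>L (distr M (F \<Otimes>\<^sub>M N) (\<lambda>\<omega>. (\<omega>, Z \<omega>))) f"
    by (rule integral_distr[symmetric]) auto
  also have "\<dots> = (\<integral>\<omega>. integral\<^sup>L (distr (Q \<omega>) (F \<Otimes>\<^sub>M N) (Pair \<omega>)) f \<partial>restr_to_subalg M F)"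
    unfolding joint_law
  proof (rule integral_bind[OF f f_bound measurable_in_subalg[OF sub measurable_prob_algebraD[OF ker]], where B'=1])
    show "finite_measure (restr_to_subalg M F)"
      by (rule finite_measure_restr_to_subalg[OF sub finite_measure_axioms])
    show "AE \<omega> in restr_to_subalg M F. emeasure (distr (Q \<omega>) (F \<Otimes>\<^sub>M N) (Pair \<omega>))
        (space (distr (Q \<omega>) (F \<Otimes>\<^sub>M N) (Pair \<omega>))) \<le> ennreal 1"
      using prob_space.emeasure_space_1[OF ker_prob]
      by (intro AE_I2) (simp add: space_restr_to_subalg)
  qed
  also have "\<dots> = expectation (\<lambda>\<omega>. integral\<^sup>L (distr (Q \<omega>) (F \<Otimes>\<^sub>M N) (Pair \<omega>)) f)"
    by (rule integral_subalgebra2[OF sub meas])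
  also have "\<dots> = expectation (\<lambda>\<omega>. \<integral>z. f (\<omega>, z) \<partial>Q \<omega>)"
    by (rule Bochner_Integration.integral_cong[OF refl inner])
  finally show ?thesis .
qed

section \<open>Conditional strong law\<close>

text \<open>Subtract from each \<open>f (\<omega>, Z j \<omega>)\<close> its mean
  \<open>p \<omega>\<close> under \<open>K \<omega>\<close>. Given \<open>F\<close>, two distinct
  variables have joint law \<open>K \<omega> \<Otimes>\<^sub>M K \<omega>\<close>, under which the
  product of the centred values integrates to 0 by Fubini. The strong law for bounded orthogonal
  variables then applies.\<close>

lemma (in prob_space) cond_slln:
  fixes Z :: "nat \<Rightarrow> 'a \<Rightarrow> 'b" and f :: "'a \<times> 'b \<Rightarrow> real"
  assumes sub: "subalgebra M F"
    and indep: "cond_indep_vars M F N Z {1..}"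
    and distr: "\<And>j. j \<ge> 1 \<Longrightarrow> has_cond_distr M F N (Z j) K"
    and K: "K \<in> F \<rightarrow>\<^sub>M prob_algebra N"
    and f [measurable]: "f \<in> borel_measurable (F \<Otimes>\<^sub>M N)"
    and f_bound: "\<And>x. x \<in> space (F \<Otimes>\<^sub>M N) \<Longrightarrow> \<bar>f x\<bar> \<le> C"
  shows "AE \<omega> in M. (\<lambda>m. (\<Sum>j=1..m. f (\<omega>, Z j \<omega>)) / real m) \<longlonglongrightarrow> (\<integral>z. f (\<omega>, z) \<partial>K \<omega>)"
proof -
  have spF: "space F = space M" using sub by (simp add: subalgebra_def)
  have Z [measurable]: "Z j \<in> M \<rightarrow>\<^sub>M N" if "j \<ge> 1" for j
    using distr[OF that] by (simp add: has_cond_distr_def)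
  have idF [measurable]: "(\<lambda>\<omega>. \<omega>) \<in> M \<rightarrow>\<^sub>M F"
    using measurable_from_subalg[OF sub, of "\<lambda>x. x" F] by auto
  have K_prob: "prob_space (K \<omega>)" "sets (K \<omega>) = sets N" if "\<omega> \<in> space M" for \<omega>
    using measurable_space[OF K, of \<omega>] that spF by (auto simp: space_prob_algebra)
  have K_space: "space (K \<omega>) = space N" if "\<omega> \<in> space M" for \<omega>
    using K_prob(2)[OF that] by (rule sets_eq_imp_space_eq)
  have f_section: "(\<lambda>z. f (\<omega>, z)) \<in> borel_measurable (K \<omega>)" if "\<omega> \<in> space M" for \<omega>
  proof -
    have [measurable_cong]: "sets (K \<omega>) = sets N" using K_prob(2)[OF that] .
    show ?thesis using that spF by measurable
  qed
  have f_le: "\<bar>f (\<omega>, z)\<bar> \<le> C" if "\<omega> \<in> space M" "z \<in> space N" for \<omega> z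
    using that spF by (intro f_bound) (simp add: space_pair_measure)
  have f_int: "integrable (K \<omega>) (\<lambda>z. f (\<omega>, z))" if \<omega>: "\<omega> \<in> space M" for \<omega>
  proof -
    interpret K: prob_space "K \<omega>" using K_prob(1)[OF \<omega>] .
    show ?thesis
      using f_section[OF \<omega>] f_le[OF \<omega>] K_space[OF \<omega>]
      by (intro K.integrable_const_bound[where B=C] AE_I2) auto
  qed
  define p where "p \<omega> = (\<integral>z. f (\<omega>, z) \<partial>K \<omega>)" for \<omega>
  have p_meas [measurable]: "p \<in> borel_measurable F"
  proof -
    \<comment> \<open>Pushing \<open>K \<omega>\<close> forward under \<open>Pair \<omega>\<close>
      turns the \<omega>-dependent integrand into the fixed function \<open>f\<close>, so
      \<open>p\<close> becomes a measurable kernel followed by integration of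
      \<open>f\<close>.\<close>
    have "(\<lambda>\<omega>. integral\<^sup>L (distr (K \<omega>) (F \<Otimes>\<^sub>M N) (Pair \<omega>)) f) \<in> borel_measurable F"
      by (rule measurable_compose[OF measurable_prob_algebraD integral_measurable_subprob_algebra[OF f]])
         (intro measurable_distr_prob_space2[OF K], simp)
    also have "?this \<longleftrightarrow> ?thesis"
    proof (rule measurable_cong)
      fix \<omega> assume \<omega>: "\<omega> \<in> space F"
      then have [measurable_cong]: "sets (K \<omega>) = sets N" using K_prob(2) spF by simp
      show "integral\<^sup>L (distr (K \<omega>) (F \<Otimes>\<^sub>M N) (Pair \<omega>)) f = p \<omega>"
        unfolding p_def using \<omega> by (intro integral_distr) auto
    qed
    finally show ?thesis .
  qed
  have p_le: "\<bar>p \<omega>\<bar> \<le> C" if \<omega>: "\<omega> \<in> space M" for \<omega>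
  proof -
    interpret K: prob_space "K \<omega>" using K_prob(1)[OF \<omega>] .
    have "\<bar>p \<omega>\<bar> \<le> (\<integral>z. \<bar>f (\<omega>, z)\<bar> \<partial>K \<omega>)" unfolding p_def by (rule integral_abs_bound)
    also have "\<dots> \<le> C"
      using f_int[OF \<omega>] f_le[OF \<omega>] K_space[OF \<omega>] by (intro K.integral_le_const AE_I2) auto
    finally show ?thesis .
  qed
  define D where "D j \<omega> = f (\<omega>, Z j \<omega>) - p \<omega>" for j \<omega>
  have D_meas [measurable]: "D j \<in> borel_measurable M" if "j \<ge> 1" for j
  proof -
    have [measurable]: "Z j \<in> M \<rightarrow>\<^sub>M N" using that by (rule Z)
    have [measurable]: "p \<in> borel_measurable M" by (rule measurable_from_subalg[OF sub p_meas])
    show ?thesis unfolding D_def by measurable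
  qed
  have Zsp: "Z j \<omega> \<in> space N" if "j \<ge> 1" "\<omega> \<in> space M" for j \<omega>
    using measurable_space[OF Z] that by blast
  have D_lim: "AE \<omega> in M. (\<lambda>m. (\<Sum>j=1..m. D j \<omega>) / real m) \<longlonglongrightarrow> 0"
  proof (rule bounded_orthogonal_slln[OF D_meas, where C="C + C"])
    show "\<bar>D j \<omega>\<bar> \<le> C + C" if "j \<ge> 1" "\<omega> \<in> space M" for j \<omega>
      using f_le[OF that(2) Zsp[OF that]] p_le[OF that(2)] unfolding D_def by linarith
  next
    fix i j :: nat assume ij: "i \<ge> 1" "j \<ge> 1" "i \<noteq> j"
    have [measurable]: "Z i \<in> M \<rightarrow>\<^sub>M N" "Z j \<in> M \<rightarrow>\<^sub>M N" using ij Z by auto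
    \<comment> \<open>Conditional independence determines the conditional law of the pair on
      rectangles only, so these form the generator.\<close>
    let ?G = "{A \<times> B | A B. A \<in> sets N \<and> B \<in> sets N}"
    let ?h = "\<lambda>(\<omega>, x, y). (f (\<omega>, x) - p \<omega>) * (f (\<omega>, y) - p \<omega>)"
    have "expectation (\<lambda>\<omega>. ?h (\<omega>, (Z i \<omega>, Z j \<omega>)))
        = expectation (\<lambda>\<omega>. \<integral>z. ?h (\<omega>, z) \<partial>(K \<omega> \<Otimes>\<^sub>M K \<omega>))"
    proof (rule cond_law_integral[OF sub, where G="?G" and N="N \<Otimes>\<^sub>M N" and C="(C + C) * (C + C)"])
      show "(\<lambda>\<omega>. K \<omega> \<Otimes>\<^sub>M K \<omega>) \<in> F \<rightarrow>\<^sub>M prob_algebra (N \<Otimes>\<^sub>M N)"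
        by (rule measurable_pair_prob[OF K K])
      show "sets (N \<Otimes>\<^sub>M N) = sigma_sets (space (N \<Otimes>\<^sub>M N)) ?G"
        by (simp add: sets_pair_measure space_pair_measure)
      show "Int_stable ?G" by (rule Int_stable_pair_measure_generator)
      show "space (N \<Otimes>\<^sub>M N) \<in> ?G" by (auto simp: space_pair_measure)
      show "?h \<in> borel_measurable (F \<Otimes>\<^sub>M (N \<Otimes>\<^sub>M N))" by measurable
      show "\<bar>?h x\<bar> \<le> (C + C) * (C + C)" if x_in: "x \<in> space (F \<Otimes>\<^sub>M (N \<Otimes>\<^sub>M N))" for x
      proof -
        obtain \<omega> u v where x: "x = (\<omega>, u, v)" by (metis prod.exhaust)
        then have "\<omega> \<in> space M" "u \<in> space N" "v \<in> space N"
          using x_in spF by (auto simp: space_pair_measure)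
        then have "\<bar>f (\<omega>, u) - p \<omega>\<bar> \<le> C + C" "\<bar>f (\<omega>, v) - p \<omega>\<bar> \<le> C + C"
          using f_le[of \<omega> u] f_le[of \<omega> v] p_le[of \<omega>] by linarith+
        then have "\<bar>f (\<omega>, u) - p \<omega>\<bar> * \<bar>f (\<omega>, v) - p \<omega>\<bar> \<le> (C + C) * (C + C)"
          by (rule mult_mono') auto
        then show ?thesis by (simp only: x prod.case abs_mult)
      qed
      fix E assume "E \<in> ?G"
      then obtain A B where E: "E = A \<times> B" and A: "A \<in> sets N" and B: "B \<in> sets N"
        by blast
      \<comment> \<open>The family of sets required by conditional independence on the index set
        \<open>{i, j}\<close>; as \<open>i \<noteq> j\<close>, it takes the value \<open>B\<close>
        at \<open>j\<close>.\<close>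
      let ?A = "\<lambda>k. if k = i then A else B"
      have vim: "(\<lambda>\<omega>. (Z i \<omega>, Z j \<omega>)) -` E \<inter> space M = (\<Inter>k\<in>{i, j}. Z k -` ?A k \<inter> space M)"
        using ij(3) unfolding E by (simp add: set_eq_iff) blast
      have "AE \<omega> in M. cond_probability M F (\<Inter>k\<in>{i, j}. Z k -` ?A k \<inter> space M) \<omega>
          = (\<Prod>k\<in>{i, j}. cond_probability M F (Z k -` ?A k \<inter> space M) \<omega>)"
        using indep ij A B unfolding cond_indep_vars_def
        by (elim conjE allE[of _ "{i, j}"] allE[of _ ?A]) auto
      moreover have "AE \<omega> in M. cond_probability M F (Z i -` A \<inter> space M) \<omega> = measure (K \<omega>) A"
        using distr[OF ij(1)] A by (simp add: has_cond_distr_def)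
      moreover have "AE \<omega> in M. cond_probability M F (Z j -` B \<inter> space M) \<omega> = measure (K \<omega>) B"
        using distr[OF ij(2)] B by (simp add: has_cond_distr_def)
      ultimately show "AE \<omega> in M. cond_probability M F ((\<lambda>\<omega>. (Z i \<omega>, Z j \<omega>)) -` E \<inter> space M) \<omega>
          = measure (K \<omega> \<Otimes>\<^sub>M K \<omega>) E"
        using AE_space
      proof eventually_elim
        case (elim \<omega>)
        interpret K: prob_space "K \<omega>" using K_prob(1)[OF elim(4)] .
        have "measure (K \<omega> \<Otimes>\<^sub>M K \<omega>) E = measure (K \<omega>) A * measure (K \<omega>) B"
          using A B K_prob(2)[OF elim(4)]
          by (simp add: E measure_def K.emeasure_pair_measure_Times enn2real_mult)
        then show ?case
          unfolding vim elim(1) using ij elim(2,3) by simp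
      qed
    qed measurable
    also have "\<dots> = expectation (\<lambda>\<omega>. 0)"
    proof (rule Bochner_Integration.integral_cong[OF refl])
      fix \<omega> assume \<omega>: "\<omega> \<in> space M"
      interpret K: prob_space "K \<omega>" using K_prob(1)[OF \<omega>] .
      interpret KK: pair_prob_space "K \<omega>" "K \<omega>" ..
      have [measurable]: "(\<lambda>z. f (\<omega>, z)) \<in> borel_measurable (K \<omega>)" by (rule f_section[OF \<omega>])
      have bd: "\<bar>f (\<omega>, z) - p \<omega>\<bar> \<le> C + C" if "z \<in> space (K \<omega>)" for z
        using f_le[OF \<omega>, of z] p_le[OF \<omega>] that K_space[OF \<omega>] by force
      have bd2: "norm (?h (\<omega>, z)) \<le> (C + C) * (C + C)" if "z \<in> space (K \<omega> \<Otimes>\<^sub>M K \<omega>)" for z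
      proof -
        have "\<bar>f (\<omega>, fst z) - p \<omega>\<bar> * \<bar>f (\<omega>, snd z) - p \<omega>\<bar> \<le> (C + C) * (C + C)"
          using that by (intro mult_mono' bd) (auto simp: space_pair_measure)
        then show ?thesis by (simp only: case_prod_unfold fst_conv snd_conv real_norm_def abs_mult)
      qed
      have "integrable (K \<omega> \<Otimes>\<^sub>M K \<omega>) (\<lambda>z. ?h (\<omega>, z))"
        by (intro KK.integrable_const_bound[where B="(C + C) * (C + C)"] AE_I2 bd2) simp_all
      then have "(\<integral>z. ?h (\<omega>, z) \<partial>(K \<omega> \<Otimes>\<^sub>M K \<omega>)) = (\<integral>x. \<integral>y. ?h (\<omega>, (x, y)) \<partial>K \<omega> \<partial>K \<omega>)"
        by (rule KK.integral_fst'[symmetric])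
      \<comment> \<open>For fixed \<open>x\<close> the first factor is constant and the second is
        centred under \<open>K \<omega>\<close>.\<close>
      also have "\<dots> = (\<integral>x. (f (\<omega>, x) - p \<omega>) * 0 \<partial>K \<omega>)"
      proof (rule Bochner_Integration.integral_cong[OF refl])
        fix x
        have "(\<integral>y. f (\<omega>, y) - p \<omega> \<partial>K \<omega>) = 0"
          using f_int[OF \<omega>] by (simp add: p_def K.prob_space)
        then show "(\<integral>y. ?h (\<omega>, (x, y)) \<partial>K \<omega>) = (f (\<omega>, x) - p \<omega>) * 0" by simp
      qed
      finally show "(\<integral>z. ?h (\<omega>, z) \<partial>(K \<omega> \<Otimes>\<^sub>M K \<omega>)) = 0" by simp
    qed
    finally show "expectation (\<lambda>\<omega>. D i \<omega> * D j \<omega>) = 0" by (simp add: D_def)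
  qed
  \<comment> \<open>At \<open>m = 0\<close> the left side is \<open>p \<omega>\<close> and the right
    side is 0, hence the restriction; it is harmless in the limit.\<close>
  have D_avg: "(\<Sum>j=1..m. D j \<omega>) / real m + p \<omega> = (\<Sum>j=1..m. f (\<omega>, Z j \<omega>)) / real m"
    if "m \<ge> 1" for m \<omega>
    using that by (simp add: D_def sum_subtractf field_simps)
  from D_lim show ?thesis
  proof eventually_elim
    case (elim \<omega>)
    have "(\<lambda>m. (\<Sum>j=1..m. D j \<omega>) / real m + p \<omega>) \<longlonglongrightarrow> 0 + p \<omega>"
      by (intro tendsto_intros elim)
    from Lim_transform_eventually[OF this, of "\<lambda>m. (\<Sum>j=1..m. f (\<omega>, Z j \<omega>)) / real m"] show ?case
      unfolding p_def[symmetric] eventually_sequentially add_0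
      by (metis (mono_tags, lifting) D_avg)
  qed
qed

section \<open>Uniform laws on varying sets\<close>

text \<open>Dominated convergence for indicators, with the indicator of \<open>B\<close> as the
  dominating function.\<close>

lemma tendsto_measure_eventually_indicator:
  assumes A [measurable]: "\<And>n. A n \<in> sets M" "L \<in> sets M"
    and B [measurable]: "B \<in> sets M" "emeasure M B < \<infinity>"
    and sub: "\<forall>\<^sub>F n in sequentially. A n \<subseteq> B"
    and lim: "\<And>x. x \<in> space M \<Longrightarrow> \<forall>\<^sub>F n in sequentially. x \<in> A n \<longleftrightarrow> x \<in> L"
  shows "(\<lambda>n. measure M (A n)) \<longlonglongrightarrow> measure M L"
proof -
  \<comment> \<open>Domination holds only from \<open>k\<close> on, so the sequence is shifted by
    \<open>k\<close> and the shift is undone at the end.\<close>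
  obtain k where k: "\<And>n. n \<ge> k \<Longrightarrow> A n \<subseteq> B"
    using sub by (auto simp: eventually_sequentially)
  have "(\<lambda>n. \<integral>x. indicator (A (n + k)) x \<partial>M) \<longlonglongrightarrow> (\<integral>x. indicator L x \<partial>M :: real)"
  proof (rule integral_dominated_convergence[where w="indicator B"])
    show "AE x in M. (\<lambda>n. indicator (A (n + k)) x :: real) \<longlonglongrightarrow> indicator L x"
    proof (rule AE_I2)
      fix x assume "x \<in> space M"
      then have "\<forall>\<^sub>F n in sequentially. (indicator (A n) x :: real) = indicator L x"
        by (rule eventually_mono[OF lim]) (simp add: indicator_def)
      then show "(\<lambda>n. indicator (A (n + k)) x :: real) \<longlonglongrightarrow> indicator L x"
        by (intro LIMSEQ_ignore_initial_segment tendsto_eventually)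
    qed
    show "AE x in M. norm (indicator (A (n + k)) x :: real) \<le> indicator B x" for n
      using k[of "n + k"] by (intro AE_I2) (auto simp: indicator_def)
  qed (use B in auto)
  then have "(\<lambda>n. measure M (A (n + k))) \<longlonglongrightarrow> measure M L"
    by simp
  then show ?thesis by (rule LIMSEQ_offset)
qed

text \<open>Normalised Lebesgue measure factors on rectangles, because intersecting two rectangles
  acts coordinatewise. This links the product law in \<open>nonconvexity\<close> to the uniform law
  on \<open>S \<times> S\<close>.\<close>

lemma pair_uniform_measure_lborel:
  fixes S :: "'a::euclidean_space set" and T :: "'b::euclidean_space set"
  assumes S: "emeasure lborel S \<noteq> 0" "emeasure lborel S \<noteq> \<infinity>"
    and T: "emeasure lborel T \<noteq> 0" "emeasure lborel T \<noteq> \<infinity>"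
  shows "uniform_measure lborel S \<Otimes>\<^sub>M uniform_measure lborel T = uniform_measure lborel (S \<times> T)"
proof (rule pair_measure_eqI)
  \<comment> \<open>A non-measurable set has \<open>emeasure\<close> 0 by convention, so nonzero
    mass yields measurability.\<close>
  have sets: "S \<in> sets borel" "T \<in> sets borel"
    using emeasure_neq_0_sets[OF S(1)] emeasure_neq_0_sets[OF T(1)] by auto
  interpret U: prob_space "uniform_measure lborel S" by (rule prob_space_uniform_measure[OF S])
  interpret V: prob_space "uniform_measure lborel T" by (rule prob_space_uniform_measure[OF T])
  show "sigma_finite_measure (uniform_measure lborel S)" "sigma_finite_measure (uniform_measure lborel T)"
    by unfold_locales
  show "sets (uniform_measure lborel S \<Otimes>\<^sub>M uniform_measure lborel T) = sets (uniform_measure lborel (S \<times> T))"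
    by (subst sets_pair_measure_cong[of _ borel _ borel]) (simp_all only: borel_prod sets_uniform_measure sets_lborel)
  fix A B assume "A \<in> sets (uniform_measure lborel S)" "B \<in> sets (uniform_measure lborel T)"
  then have AB: "A \<in> sets borel" "B \<in> sets borel" by auto
  have times: "emeasure lborel (X \<times> Y) = emeasure lborel X * emeasure lborel Y"
    if "X \<in> sets borel" "Y \<in> sets borel" for X :: "'a set" and Y :: "'b set"
    using that by (simp add: lborel_prod[symmetric] lborel.emeasure_pair_measure_Times)
  have le: "emeasure lborel (S \<inter> A) \<le> emeasure lborel S" "emeasure lborel (T \<inter> B) \<le> emeasure lborel T"
    using sets by (auto intro: emeasure_mono)
  have fin: "emeasure lborel (S \<inter> A) \<noteq> \<infinity>" "emeasure lborel (T \<inter> B) \<noteq> \<infinity>"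
    using S(2) T(2) neq_top_trans[OF _ le(1)] neq_top_trans[OF _ le(2)] by auto
  \<comment> \<open>All four masses are finite, so the identity of quotients can be checked with
    real numbers.\<close>
  obtain a where a: "emeasure lborel S = ennreal a" "a > 0"
    using S by (cases "emeasure lborel S") (auto simp: less_le)
  obtain b where b: "emeasure lborel T = ennreal b" "b > 0"
    using T by (cases "emeasure lborel T") (auto simp: less_le)
  obtain c where c: "emeasure lborel (S \<inter> A) = ennreal c" "c \<ge> 0"
    using fin(1) by (cases "emeasure lborel (S \<inter> A)") auto
  obtain d where d: "emeasure lborel (T \<inter> B) = ennreal d" "d \<ge> 0"
    using fin(2) by (cases "emeasure lborel (T \<inter> B)") auto
  show "emeasure (uniform_measure lborel S) A * emeasure (uniform_measure lborel T) B
      = emeasure (uniform_measure lborel (S \<times> T)) (A \<times> B)"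
    using sets AB a b c d
    by (simp add: times borel_Times Times_Int_Times divide_ennreal ennreal_mult[symmetric])
qed

text \<open>The mass of \<open>A\<close> is the quotient of the volumes of
  \<open>T \<omega> \<inter> A\<close> and \<open>T \<omega>\<close>. Both are volumes of sections
  of product-measurable sets, hence measurable in \<omega>.\<close>

lemma uniform_kernel_measurable:
  fixes T :: "'a \<Rightarrow> 'b::euclidean_space set"
  assumes graph: "{x \<in> space (F \<Otimes>\<^sub>M borel). snd x \<in> T (fst x)} \<in> sets (F \<Otimes>\<^sub>M borel)"
    and pos: "\<And>\<omega>. \<omega> \<in> space F \<Longrightarrow> emeasure lborel (T \<omega>) \<noteq> 0"
    and fin: "\<And>\<omega>. \<omega> \<in> space F \<Longrightarrow> emeasure lborel (T \<omega>) \<noteq> \<infinity>"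
  shows "(\<lambda>\<omega>. uniform_measure lborel (T \<omega>)) \<in> F \<rightarrow>\<^sub>M prob_algebra borel"
proof (rule measurable_prob_algebra_generated[where \<Omega>=UNIV and G="sets borel"])
  show "sets (borel :: 'b measure) = sigma_sets UNIV (sets borel)"
    using sets.sigma_sets_eq[of "borel :: 'b measure"] by simp
  show "Int_stable (sets (borel :: 'b measure))" by (auto simp: Int_stable_def)
  show "prob_space (uniform_measure lborel (T \<omega>))" if "\<omega> \<in> space F" for \<omega>
    using that pos fin by (intro prob_space_uniform_measure)
  fix A :: "'b set" assume A [measurable]: "A \<in> sets borel"
  let ?H = "{x \<in> space (F \<Otimes>\<^sub>M borel). snd x \<in> T (fst x)}"
  note [measurable] = graph
  have HA: "{x \<in> space (F \<Otimes>\<^sub>M borel). x \<in> ?H \<and> snd x \<in> A} \<in> sets (F \<Otimes>\<^sub>M borel)" by measurable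
  have sl: "sets (F \<Otimes>\<^sub>M (lborel :: 'b measure)) = sets (F \<Otimes>\<^sub>M borel)"
    by (intro sets_pair_measure_cong) auto
  have m1: "(\<lambda>\<omega>. emeasure lborel (Pair \<omega> -` ?H)) \<in> borel_measurable F"
    by (rule lborel.measurable_emeasure_Pair) (use graph sl in simp)
  have m2: "(\<lambda>\<omega>. emeasure lborel (Pair \<omega> -` {x \<in> space (F \<Otimes>\<^sub>M borel). x \<in> ?H \<and> snd x \<in> A})) \<in> borel_measurable F"
    by (rule lborel.measurable_emeasure_Pair) (use HA sl in simp)
  have "(\<lambda>\<omega>. emeasure lborel (Pair \<omega> -` {x \<in> space (F \<Otimes>\<^sub>M borel). x \<in> ?H \<and> snd x \<in> A})
      / emeasure lborel (Pair \<omega> -` ?H)) \<in> borel_measurable F"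
    using m1 m2 by measurable
  also have "?this \<longleftrightarrow> (\<lambda>\<omega>. emeasure (uniform_measure lborel (T \<omega>)) A) \<in> borel_measurable F"
  proof (rule measurable_cong)
    fix \<omega> assume \<omega>: "\<omega> \<in> space F"
    have "Pair \<omega> -` ?H = T \<omega>" "Pair \<omega> -` {x \<in> space (F \<Otimes>\<^sub>M borel). x \<in> ?H \<and> snd x \<in> A} = T \<omega> \<inter> A"
      using \<omega> by (auto simp: space_pair_measure)
    moreover have "T \<omega> \<in> sets lborel" using pos[OF \<omega>] by (rule emeasure_neq_0_sets)
    ultimately show "emeasure lborel (Pair \<omega> -` {x \<in> space (F \<Otimes>\<^sub>M borel). x \<in> ?H \<and> snd x \<in> A})
        / emeasure lborel (Pair \<omega> -` ?H) = emeasure (uniform_measure lborel (T \<omega>)) A"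
      by simp
  qed
  finally show "(\<lambda>\<omega>. emeasure (uniform_measure lborel (T \<omega>)) A) \<in> borel_measurable F" .
qed auto

text \<open>A point of \<open>S\<close> lies in \<open>T n\<close> eventually by
  \<open>lower\<close>; a point outside the closed set \<open>S\<close> has positive distance from
  it and leaves \<open>T n\<close> once \<open>\<epsilon> n\<close> is smaller. So numerator and
  denominator of the midpoint probability converge, and the limiting denominator is
  positive.\<close>

lemma uniform_midpoint_tendsto:
  fixes S :: "'a::euclidean_space set"
  assumes S: "compact S" "emeasure lborel S > 0"
    and T: "\<And>n. T n \<in> sets borel"
    and \<epsilon>: "\<epsilon> \<longlonglongrightarrow> 0"
    and lower: "\<forall>\<^sub>F n in sequentially. S \<subseteq> T n"
    and upper: "\<And>n. T n \<subseteq> (\<Union>x\<in>S. cball x (\<epsilon> n))"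
  shows "(\<lambda>n. measure (uniform_measure lborel (T n \<times> T n)) {(x, y). (1 / 2) *\<^sub>R (x + y) \<in> T n})
    \<longlonglongrightarrow> measure (uniform_measure lborel (S \<times> S)) {(x, y). (1 / 2) *\<^sub>R (x + y) \<in> S}"
proof -
  \<comment> \<open>The numerator set: pairs from \<open>A\<close> whose midpoint is again in
    \<open>A\<close>.\<close>
  define W where "W A = A \<times> A \<inter> {(x, y). (1 / 2) *\<^sub>R (x + y) \<in> A}" for A :: "'a set"
  have mid_sets: "{(x, y). (1 / 2) *\<^sub>R (x + y) \<in> A} \<in> sets borel"
    if "A \<in> sets borel" for A :: "'a set"
  proof -
    have "(\<lambda>z. (1 / 2) *\<^sub>R (fst z + snd z)) -` A \<inter> space (borel :: ('a \<times> 'a) measure) \<in> sets borel"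
      by (rule measurable_sets[OF borel_measurable_continuous_onI that]) (intro continuous_intros)
    then show ?thesis by (simp add: vimage_def case_prod_unfold)
  qed
  have times_sets: "A \<times> A \<in> sets borel" if "A \<in> sets borel" for A :: "'a set"
    using that by (intro borel_Times)
  have W_sets: "W A \<in> sets borel" if "A \<in> sets borel" for A
    unfolding W_def using mid_sets[OF that] times_sets[OF that] by (rule sets.Int[rotated])
  have S_sets: "S \<in> sets borel" using S(1) by (simp add: borel_compact)
  obtain r where r: "S \<subseteq> ball 0 r" using S(1) compact_imp_bounded bounded_subset_ballD by blast
  \<comment> \<open>The extra 1 leaves room for \<open>T n\<close> as soon as
    \<open>\<epsilon> n < 1\<close>; \<open>B \<times> B\<close> then dominates.\<close>
  define B where "B = ball (0::'a) (r + 1)"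
  have TB: "\<forall>\<^sub>F n in sequentially. T n \<subseteq> B"
  proof -
    have "\<forall>\<^sub>F n in sequentially. \<epsilon> n < 1" using \<epsilon> by (rule order_tendstoD) simp
    then show ?thesis
    proof eventually_elim
      case (elim n)
      show ?case
      proof
        fix y assume "y \<in> T n"
        then obtain x where x: "x \<in> S" "dist x y \<le> \<epsilon> n" using upper[of n] by auto
        then have "dist 0 x < r" using r by auto
        then show "y \<in> B" using x elim dist_triangle[of 0 y x] by (simp add: B_def)
      qed
    qed
  qed
  have pt: "\<forall>\<^sub>F n in sequentially. x \<in> T n \<longleftrightarrow> x \<in> S" for x
  proof (cases "x \<in> S")
    case True
    then show ?thesis using lower by (auto elim: eventually_mono)
  next
    case False
    then obtain d where d: "d > 0" "ball x d \<subseteq> - S"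
      using compact_imp_closed[OF S(1)] open_contains_ball[of "- S"] by (auto simp: open_Compl)
    have "\<forall>\<^sub>F n in sequentially. \<epsilon> n < d" using \<epsilon> d(1) by (rule order_tendstoD(2))
    then show ?thesis
    proof eventually_elim
      case (elim n)
      have "x \<notin> T n"
      proof
        assume "x \<in> T n"
        then obtain s where "s \<in> S" "dist s x \<le> \<epsilon> n" using upper[of n] by auto
        with elim d show False by (auto simp: subset_eq dist_commute)
      qed
      with False show ?case by simp
    qed
  qed
  have B_fin: "emeasure lborel (B \<times> B) < \<infinity>"
    unfolding B_def by (intro emeasure_bounded_finite bounded_Times bounded_ball)
  have B_sets: "B \<times> B \<in> sets lborel" unfolding B_def by (intro sets_lborel[THEN equalityD2, THEN subsetD] times_sets) simp
  have lim1: "(\<lambda>n. measure lborel (T n \<times> T n)) \<longlonglongrightarrow> measure lborel (S \<times> S)"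
  proof (rule tendsto_measure_eventually_indicator[where A="\<lambda>n. T n \<times> T n", OF _ _ B_sets B_fin])
    show "\<forall>\<^sub>F n in sequentially. T n \<times> T n \<subseteq> B \<times> B" using TB by eventually_elim (rule Sigma_mono)
    show "\<forall>\<^sub>F n in sequentially. z \<in> T n \<times> T n \<longleftrightarrow> z \<in> S \<times> S" for z
      using pt[of "fst z"] pt[of "snd z"] by eventually_elim (auto simp: mem_Times_iff)
  qed (simp_all add: times_sets T S_sets)
  have lim2: "(\<lambda>n. measure lborel (W (T n))) \<longlonglongrightarrow> measure lborel (W S)"
  proof (rule tendsto_measure_eventually_indicator[where A="\<lambda>n. W (T n)", OF _ _ B_sets B_fin])
    show "\<forall>\<^sub>F n in sequentially. W (T n) \<subseteq> B \<times> B" using TB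
      by eventually_elim (unfold W_def, blast)
    \<comment> \<open>Membership of a pair in \<open>W (T n)\<close> is decided by three points: its
      two coordinates and their midpoint.\<close>
    show "\<forall>\<^sub>F n in sequentially. z \<in> W (T n) \<longleftrightarrow> z \<in> W S" for z
      using pt[of "fst z"] pt[of "snd z"] pt[of "(1 / 2) *\<^sub>R (fst z + snd z)"]
      by eventually_elim (auto simp: W_def mem_Times_iff case_prod_unfold)
  qed (simp_all add: W_sets T S_sets)
  \<comment> \<open>Stated for every \<open>A\<close> between \<open>S\<close> and \<open>B\<close>,
    so that it covers both the limit \<open>S\<close> and \<open>T n\<close> for large
    \<open>n\<close>.\<close>
  have eq: "measure (uniform_measure lborel (A \<times> A)) {(x, y). (1 / 2) *\<^sub>R (x + y) \<in> A}
      = measure lborel (W A) / measure lborel (A \<times> A)"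
    and nz: "measure lborel (A \<times> A) \<noteq> 0"
    if A: "A \<in> sets borel" "S \<subseteq> A" "A \<subseteq> B" for A
  proof -
    have "emeasure lborel (S \<times> S) = emeasure lborel S * emeasure lborel S"
      using S_sets by (simp add: lborel_prod[symmetric] lborel.emeasure_pair_measure_Times)
    moreover have "emeasure lborel (S \<times> S) \<le> emeasure lborel (A \<times> A)"
      using A by (intro emeasure_mono) (auto simp: times_sets)
    ultimately have 1: "emeasure lborel (A \<times> A) \<noteq> 0" using S(2) by auto
    have "emeasure lborel (A \<times> A) \<le> emeasure lborel (B \<times> B)"
      using A B_sets by (intro emeasure_mono) auto
    then have 2: "emeasure lborel (A \<times> A) \<noteq> \<infinity>" using B_fin by auto
    show "measure (uniform_measure lborel (A \<times> A)) {(x, y). (1 / 2) *\<^sub>R (x + y) \<in> A}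
      = measure lborel (W A) / measure lborel (A \<times> A)"
      using mid_sets[OF A(1)] by (simp add: measure_uniform_measure[OF 1 2] W_def)
    show "measure lborel (A \<times> A) \<noteq> 0"
      using 1 2 by (simp add: measure_def enn2real_eq_0_iff)
  qed
  have SB: "S \<subseteq> B" using r by (auto simp: B_def)
  have "(\<lambda>n. measure lborel (W (T n)) / measure lborel (T n \<times> T n)) \<longlonglongrightarrow> measure lborel (W S) / measure lborel (S \<times> S)"
    by (intro tendsto_divide lim1 lim2 nz S_sets SB order_refl)
  moreover have "\<forall>\<^sub>F n in sequentially. measure lborel (W (T n)) / measure lborel (T n \<times> T n)
      = measure (uniform_measure lborel (T n \<times> T n)) {(x, y). (1 / 2) *\<^sub>R (x + y) \<in> T n}"
    using lower TB by eventually_elim (simp add: eq T)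
  ultimately show ?thesis
    unfolding eq[OF S_sets order_refl SB] by (rule Lim_transform_eventually)
qed

section \<open>The thickened sample as a random set\<close>

lemma thickening_sample: "thickening (sample X n \<omega>) e = (\<Union>i\<in>{1..n}. cball (X i \<omega>) e)"
  by (simp add: thickening_def sample_def)

lemma compact_thickening_sample: "compact (thickening (sample X n \<omega>) e)"
  unfolding thickening_sample by (intro compact_UN) auto

lemma subalgebra_sample_algebra:
  assumes "\<And>i. i \<ge> 1 \<Longrightarrow> X i \<in> borel_measurable M"
  shows "subalgebra M (sample_algebra M X n)"
proof -
  have "(\<lambda>\<omega>. \<lambda>i\<in>{1..n}. X i \<omega>) \<in> M \<rightarrow>\<^sub>M Pi\<^sub>M {1..n} (\<lambda>_. borel)"
    by (rule measurable_restrict) (rule assms, simp)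
  from sets_image_in_sets[OF refl this] show ?thesis
    by (simp add: subalgebra_def sample_algebra_def)
qed

lemma measurable_sample_algebra_component:
  assumes "i \<in> {1..n}"
  shows "X i \<in> borel_measurable (sample_algebra M X n)"
proof -
  have "(\<lambda>\<omega>. \<lambda>i\<in>{1..n}. X i \<omega>) \<in> sample_algebra M X n \<rightarrow>\<^sub>M Pi\<^sub>M {1..n} (\<lambda>_. borel)"
    unfolding sample_algebra_def by (intro measurable_vimage_algebra1) (auto simp: space_PiM)
  from measurable_compose[OF this measurable_component_singleton[OF assms]] assms
  show ?thesis by simp
qed

text \<open>The graph is a finite union of closed conditions on the distance to \<open>X i\<close>,
  each jointly measurable. It supplies the graph hypothesis for uniform kernels.\<close>

lemma sets_graph_thickening_sample:
  "{x \<in> space (sample_algebra M X n \<Otimes>\<^sub>M borel). snd x \<in> thickening (sample X n (fst x)) e}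
    \<in> sets (sample_algebra M X n \<Otimes>\<^sub>M borel)"
proof -
  let ?P = "sample_algebra M X n \<Otimes>\<^sub>M borel"
  have "{x \<in> space ?P. dist (X i (fst x)) (snd x) \<le> e} \<in> sets ?P" if "i \<in> {1..n}" for i
  proof -
    note [measurable] = measurable_sample_algebra_component[OF that, of X M]
    show ?thesis by measurable
  qed
  then have "(\<Union>i\<in>{1..n}. {x \<in> space ?P. dist (X i (fst x)) (snd x) \<le> e}) \<in> sets ?P"
    by (intro sets.finite_UN) auto
  also have "(\<Union>i\<in>{1..n}. {x \<in> space ?P. dist (X i (fst x)) (snd x) \<le> e})
      = {x \<in> space ?P. snd x \<in> thickening (sample X n (fst x)) e}"
    unfolding thickening_sample by auto
  finally show ?thesis .
qed

lemma emeasure_lborel_square: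
  fixes A :: "'a::euclidean_space set"
  assumes "A \<in> sets borel"
  shows "emeasure lborel (A \<times> A) = emeasure lborel A * emeasure lborel A"
  using assms by (simp add: lborel_prod[symmetric] lborel.emeasure_pair_measure_Times)

lemma emeasure_thickening_sample_square:
  fixes X :: "nat \<Rightarrow> 'w \<Rightarrow> real ^ 'd"
  assumes "n \<ge> 1" "e > 0"
  defines "T \<omega> \<equiv> thickening (sample X n \<omega>) e"
  shows "emeasure lborel (T \<omega> \<times> T \<omega>) \<noteq> 0" "emeasure lborel (T \<omega> \<times> T \<omega>) \<noteq> \<infinity>"
proof -
  have T: "compact (T \<omega>)" unfolding T_def by (rule compact_thickening_sample)
  then have T_sets: "T \<omega> \<in> sets borel" by (rule borel_compact)
  \<comment> \<open>Since \<open>n \<ge> 1\<close>, the point \<open>X 1 \<omega>\<close> is in the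
    sample, and \<open>T \<omega>\<close> contains a whole ball around it.\<close>
  have "0 < measure lborel (ball (X 1 \<omega>) e)" using assms(2) by (rule content_ball_pos)
  then have "0 < emeasure lborel (ball (X 1 \<omega>) e)"
    by (simp add: measure_def enn2real_positive_iff)
  also have "\<dots> \<le> emeasure lborel (T \<omega>)"
    using assms(1) T_sets unfolding T_def thickening_sample
    by (intro emeasure_mono) (auto intro!: bexI[of _ 1])
  finally show "emeasure lborel (T \<omega> \<times> T \<omega>) \<noteq> 0"
    by (simp add: emeasure_lborel_square[OF T_sets])
  show "emeasure lborel (T \<omega> \<times> T \<omega>) \<noteq> \<infinity>"
    using emeasure_compact_finite[OF compact_Times[OF T T]] by simp
qed

section \<open>The inner limit and the law of two sample points\<close>

text \<open>The conditional strong law applied to the indicator that the midpoint of a pair lies in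
  \<open>T \<omega>\<close>. The work lies in showing that this indicator and the uniform kernel on
  \<open>T \<omega> \<times> T \<omega>\<close> are measurable for the sample sigma-algebra.\<close>

lemma midpoint_freq_tendsto:
  fixes M :: "'w measure" and X :: "nat \<Rightarrow> 'w \<Rightarrow> real ^ 'd"
    and Z :: "nat \<Rightarrow> 'w \<Rightarrow> (real ^ 'd) \<times> (real ^ 'd)"
  assumes M: "prob_space M"
    and X: "\<And>i. i \<ge> 1 \<Longrightarrow> X i \<in> borel_measurable M"
    and n: "n \<ge> 1" and e: "e > 0"
    and T: "\<And>\<omega>. T \<omega> = thickening (sample X n \<omega>) e"
    and indep: "cond_indep_vars M (sample_algebra M X n) borel Z {1..}"
    and distr: "\<And>j. j \<ge> 1 \<Longrightarrow> has_cond_distr M (sample_algebra M X n) borel (Z j)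
      (\<lambda>\<omega>. uniform_measure lborel (T \<omega> \<times> T \<omega>))"
  shows "AE \<omega> in M. (\<lambda>m. midpoint_freq m (T \<omega>) (\<lambda>j. Z j \<omega>)) \<longlonglongrightarrow>
    measure (uniform_measure lborel (T \<omega> \<times> T \<omega>)) {(x, y). (1 / 2) *\<^sub>R (x + y) \<in> T \<omega>}"
proof -
  interpret prob_space M by (rule M)
  let ?F = "sample_algebra M X n"
  let ?N = "borel :: ((real ^ 'd) \<times> (real ^ 'd)) measure"
  let ?G = "{x \<in> space (?F \<Otimes>\<^sub>M borel). snd x \<in> T (fst x)}"
  have sub: "subalgebra M ?F" by (rule subalgebra_sample_algebra[OF X])
  have graph: "?G \<in> sets (?F \<Otimes>\<^sub>M borel)"
    unfolding T by (rule sets_graph_thickening_sample)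
  \<comment> \<open>One pullback of the graph serves three maps: the two projections, which give the
    graph of \<open>T \<omega> \<times> T \<omega>\<close>, and the midpoint map, which gives the
    indicator.\<close>
  have vimage_graph: "{x \<in> space (?F \<Otimes>\<^sub>M ?N). g (snd x) \<in> T (fst x)} \<in> sets (?F \<Otimes>\<^sub>M ?N)"
    if "continuous_on UNIV g" for g
  proof -
    have [measurable]: "g \<in> borel_measurable borel"
      using that by (rule borel_measurable_continuous_onI)
    have m: "(\<lambda>x. (fst x, g (snd x))) \<in> ?F \<Otimes>\<^sub>M ?N \<rightarrow>\<^sub>M ?F \<Otimes>\<^sub>M borel"
      by measurable
    from measurable_sets[OF m graph]
    show ?thesis
      by (rule back_subst[where P="\<lambda>A. A \<in> _"]) (auto simp: space_pair_measure)
  qed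
  have "{x \<in> space (?F \<Otimes>\<^sub>M ?N). fst (snd x) \<in> T (fst x)} \<inter>
      {x \<in> space (?F \<Otimes>\<^sub>M ?N). snd (snd x) \<in> T (fst x)} \<in> sets (?F \<Otimes>\<^sub>M ?N)"
    by (intro sets.Int vimage_graph continuous_intros)
  also have "{x \<in> space (?F \<Otimes>\<^sub>M ?N). fst (snd x) \<in> T (fst x)} \<inter>
      {x \<in> space (?F \<Otimes>\<^sub>M ?N). snd (snd x) \<in> T (fst x)}
      = {x \<in> space (?F \<Otimes>\<^sub>M ?N). snd x \<in> T (fst x) \<times> T (fst x)}"
    by (auto simp: mem_Times_iff)
  finally have kernel: "(\<lambda>\<omega>. uniform_measure lborel (T \<omega> \<times> T \<omega>)) \<in> ?F \<rightarrow>\<^sub>M prob_algebra borel"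
    by (rule uniform_kernel_measurable) (unfold T, (rule emeasure_thickening_sample_square[OF n e])+)
  let ?f = "\<lambda>x. indicat_real (T (fst x)) ((1 / 2) *\<^sub>R (fst (snd x) + snd (snd x)))"
  have "{x \<in> space (?F \<Otimes>\<^sub>M ?N). (1 / 2) *\<^sub>R (fst (snd x) + snd (snd x)) \<in> T (fst x)} \<in> sets (?F \<Otimes>\<^sub>M ?N)"
    by (rule vimage_graph) (intro continuous_intros)
  then have "indicat_real {x \<in> space (?F \<Otimes>\<^sub>M ?N). (1 / 2) *\<^sub>R (fst (snd x) + snd (snd x)) \<in> T (fst x)}
      \<in> borel_measurable (?F \<Otimes>\<^sub>M ?N)"
    by (rule borel_measurable_indicator)
  also have "?this \<longleftrightarrow> ?f \<in> borel_measurable (?F \<Otimes>\<^sub>M ?N)"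
    by (rule measurable_cong) (simp add: indicator_def)
  finally have f: "?f \<in> borel_measurable (?F \<Otimes>\<^sub>M ?N)" .
  have "AE \<omega> in M. (\<lambda>m. (\<Sum>j=1..m. ?f (\<omega>, Z j \<omega>)) / real m)
      \<longlonglongrightarrow> (\<integral>z. ?f (\<omega>, z) \<partial>uniform_measure lborel (T \<omega> \<times> T \<omega>))"
    by (rule cond_slln[OF sub indep distr kernel f, where C=1]) (auto simp: indicator_def)
  moreover have "(\<integral>z. ?f (\<omega>, z) \<partial>uniform_measure lborel (T \<omega> \<times> T \<omega>))
      = measure (uniform_measure lborel (T \<omega> \<times> T \<omega>)) {(x, y). (1 / 2) *\<^sub>R (x + y) \<in> T \<omega>}" for \<omega>
  proof -
    have "(\<integral>z. ?f (\<omega>, z) \<partial>uniform_measure lborel (T \<omega> \<times> T \<omega>))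
        = (\<integral>z. indicator {(x, y). (1 / 2) *\<^sub>R (x + y) \<in> T \<omega>} z \<partial>uniform_measure lborel (T \<omega> \<times> T \<omega>))"
      by (intro Bochner_Integration.integral_cong) (auto simp: indicator_def)
    then show ?thesis by simp
  qed
  ultimately show ?thesis
    by (simp add: midpoint_freq_def)
qed

lemma (in prob_space) measure_pair_indep_vars:
  assumes "indep_vars (\<lambda>_. N) X I" "i \<in> I" "j \<in> I" "i \<noteq> j"
    and A: "{z. P z} \<in> sets (N \<Otimes>\<^sub>M N)"
  shows "measure M {\<omega> \<in> space M. P (X i \<omega>, X j \<omega>)}
    = measure (distr M N (X i) \<Otimes>\<^sub>M distr M N (X j)) {z. P z}"
proof -
  have rv [measurable]: "random_variable N (X i)" "random_variable N (X j)"
    using assms by (auto simp: indep_vars_def)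
  \<comment> \<open>Independence of the family is first restricted to the disjoint blocks
    \<open>{i}\<close> and \<open>{j}\<close>; evaluating the only coordinate then recovers
    \<open>X i\<close> and \<open>X j\<close>.\<close>
  have "indep_var (Pi\<^sub>M {i} (\<lambda>_. N)) (\<lambda>\<omega>. \<lambda>i\<in>{i}. X i \<omega>) (Pi\<^sub>M {j} (\<lambda>_. N)) (\<lambda>\<omega>. \<lambda>i\<in>{j}. X i \<omega>)"
    using assms by (intro indep_var_restrict[of _ X I]) auto
  from indep_var_compose[OF this, of "\<lambda>x. x i" N "\<lambda>x. x j" N]
  have "indep_var N (X i) N (X j)"
    by (simp add: comp_def measurable_component_singleton)
  then have joint: "distr M N (X i) \<Otimes>\<^sub>M distr M N (X j) = distr M (N \<Otimes>\<^sub>M N) (\<lambda>\<omega>. (X i \<omega>, X j \<omega>))"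
    by (simp add: indep_var_distribution_eq)
  show ?thesis
    unfolding joint using A
    by (subst measure_distr) (auto intro!: arg_cong[where f="measure M"])
qed

section \<open>Assembling the iterated limit\<close>

theorem theorem4p3:
  fixes M :: "'w measure"
    and S :: "(real ^ 'd) set"
    and X :: "nat \<Rightarrow> 'w \<Rightarrow> real ^ 'd"
    and Z :: "nat \<Rightarrow> nat \<Rightarrow> 'w \<Rightarrow> (real ^ 'd) \<times> (real ^ 'd)"
    and \<epsilon> :: "nat \<Rightarrow> real"
    and Sn :: "nat \<Rightarrow> 'w \<Rightarrow> (real ^ 'd) set"
  assumes "prob_space M"
    and "compact S"
    and "emeasure lborel S > 0"
    and "emeasure lborel (frontier S) = 0"
    and "prob_space.indep_vars M (\<lambda>_. borel) X {1..}"
    and "\<And>i. i \<ge> 1 \<Longrightarrow> distr M borel (X i) = uniform_measure lborel S"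
    and "\<And>n. n \<ge> 1 \<Longrightarrow> \<epsilon> n > 0"
    and "\<epsilon> \<longlonglongrightarrow> 0"
    and "\<And>n \<omega>. Sn n \<omega> = thickening (sample X n \<omega>) (\<epsilon> n)"
    and "AE \<omega> in M. \<forall>\<^sub>F n in sequentially. S \<subseteq> Sn n \<omega>"
    and "\<And>n. n \<ge> 1 \<Longrightarrow> cond_indep_vars M (sample_algebra M X n) borel (Z n) {1..}"
    and "\<And>n j. n \<ge> 1 \<Longrightarrow> j \<ge> 1 \<Longrightarrow>
           has_cond_distr M (sample_algebra M X n) borel (Z n j)
             (\<lambda>\<omega>. uniform_measure lborel (Sn n \<omega> \<times> Sn n \<omega>))"
  shows "(AE \<omega> in M. iterated_limit
            (\<lambda>n m. nonconvexity_est m (Sn n \<omega>) (\<lambda>j. Z n j \<omega>)) (nonconvexity S)) \<and>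
         (AE \<omega> in M. iterated_limit
            (\<lambda>n m. midpoint_freq m (Sn n \<omega>) (\<lambda>j. Z n j \<omega>))
            (measure M {\<omega>' \<in> space M. (1 / 2) *\<^sub>R (X 1 \<omega>' + X 2 \<omega>') \<in> S}))"
proof -
  interpret prob_space M by fact
  let ?U = "uniform_measure lborel S"
  let ?mid = "\<lambda>A. {(x, y). (1 / 2) *\<^sub>R (x + y) \<in> A} :: ((real ^ 'd) \<times> (real ^ 'd)) set"
  \<comment> \<open>The common value of the midpoint probability on the product space, used by
    \<open>nonconvexity\<close>, and of the one for \<open>X 1\<close> and \<open>X 2\<close> on
    \<open>M\<close>.\<close>
  define q where "q = measure (uniform_measure lborel (S \<times> S)) (?mid S)"
  have X: "X i \<in> borel_measurable M" if "i \<ge> 1" for i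
    using assms(5) that by (auto simp: indep_vars_def)
  have S: "S \<in> sets borel" "emeasure lborel S \<noteq> 0" "emeasure lborel S \<noteq> \<infinity>"
    using assms(3) borel_compact[OF assms(2)] emeasure_compact_finite[OF assms(2)] by auto
  have q_pair: "measure (?U \<Otimes>\<^sub>M ?U) (?mid S) = q"
    by (simp add: q_def pair_uniform_measure_lborel[OF S(2,3) S(2,3)])
  have q_prob: "measure M {\<omega>' \<in> space M. (1 / 2) *\<^sub>R (X 1 \<omega>' + X 2 \<omega>') \<in> S} = q"
  proof -
    have [measurable]: "S \<in> sets borel" by (rule S(1))
    have "{z. (1 / 2) *\<^sub>R (fst z + snd z) \<in> S} \<inter> space (borel \<Otimes>\<^sub>M borel) \<in> sets (borel \<Otimes>\<^sub>M borel)"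
      by measurable
    then have "{z. (1 / 2) *\<^sub>R (fst z + snd z) \<in> S} \<in> sets (borel \<Otimes>\<^sub>M borel)"
      by (simp add: space_pair_measure)
    from measure_pair_indep_vars[OF assms(5) _ _ _ this, of 1 2]
    show ?thesis
      by (simp add: assms(6) q_pair[symmetric] case_prod_unfold)
  qed
  \<comment> \<open>Countably many null sets, one for each \<open>n\<close>, are merged, so that a
    single \<omega> serves all inner limits.\<close>
  have inner: "AE \<omega> in M. \<forall>n\<ge>1. (\<lambda>m. midpoint_freq m (Sn n \<omega>) (\<lambda>j. Z n j \<omega>)) \<longlonglongrightarrow>
      measure (uniform_measure lborel (Sn n \<omega> \<times> Sn n \<omega>)) (?mid (Sn n \<omega>))"
    unfolding AE_all_countable
  proof
    fix n
    show "AE \<omega> in M. n \<ge> 1 \<longrightarrow> (\<lambda>m. midpoint_freq m (Sn n \<omega>) (\<lambda>j. Z n j \<omega>)) \<longlonglongrightarrow>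
      measure (uniform_measure lborel (Sn n \<omega> \<times> Sn n \<omega>)) (?mid (Sn n \<omega>))"
    proof (cases "n \<ge> 1")
      case True
      then have "AE \<omega> in M. (\<lambda>m. midpoint_freq m (Sn n \<omega>) (\<lambda>j. Z n j \<omega>)) \<longlonglongrightarrow>
          measure (uniform_measure lborel (Sn n \<omega> \<times> Sn n \<omega>)) (?mid (Sn n \<omega>))"
        by (intro midpoint_freq_tendsto[where X=X and e="\<epsilon> n" and n=n] assms(1,7,9,11,12) X)
      then show ?thesis by eventually_elim simp
    qed simp
  qed
  \<comment> \<open>With all sample points in \<open>S\<close>, the set \<open>Sn n \<omega>\<close>
    stays within distance \<open>\<epsilon> n\<close> of \<open>S\<close>, which is the upper
    inclusion for the outer limit.\<close>
  have "AE \<omega> in M. \<forall>i. i \<ge> 1 \<longrightarrow> X i \<omega> \<in> S"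
    unfolding AE_all_countable
  proof
    fix i :: nat
    show "AE \<omega> in M. i \<ge> 1 \<longrightarrow> X i \<omega> \<in> S"
    proof (cases "i \<ge> 1")
      case True
      have "AE x in distr M borel (X i). x \<in> S"
        unfolding assms(6)[OF True] using S(1) by (intro AE_uniform_measureI) auto
      then have "AE \<omega> in M. X i \<omega> \<in> S"
        by (rule AE_distrD[OF X[OF True]])
      then show ?thesis by eventually_elim simp
    qed simp
  qed
  with inner assms(10)
  have main: "AE \<omega> in M. iterated_limit (\<lambda>n m. midpoint_freq m (Sn n \<omega>) (\<lambda>j. Z n j \<omega>)) q"
  proof eventually_elim
    case (elim \<omega>)
    have "(\<lambda>n. measure (uniform_measure lborel (Sn n \<omega> \<times> Sn n \<omega>)) (?mid (Sn n \<omega>))) \<longlonglongrightarrow> q"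
      unfolding q_def
    proof (rule uniform_midpoint_tendsto[OF assms(2,3) _ assms(8) elim(2)])
      show "Sn n \<omega> \<in> sets borel" for n
        unfolding assms(9) by (rule borel_compact[OF compact_thickening_sample])
      \<comment> \<open>This includes \<open>n = 0\<close>, where the sample and hence
        \<open>Sn 0 \<omega>\<close> are empty.\<close>
      show "Sn n \<omega> \<subseteq> (\<Union>x\<in>S. cball x (\<epsilon> n))" for n
        unfolding assms(9) thickening_sample using elim(3) by (intro UN_least) force
    qed
    with elim(1) show ?case
      unfolding iterated_limit_def
      by (intro exI[of _ "\<lambda>n. measure (uniform_measure lborel (Sn n \<omega> \<times> Sn n \<omega>)) (?mid (Sn n \<omega>))"] conjI)
  qed
  moreover have "iterated_limit (\<lambda>n m. 1 - a n m) (1 - l)" if a: "iterated_limit a l" for a l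
  proof -
    obtain L where L: "\<And>n. n \<ge> 1 \<Longrightarrow> (\<lambda>m. a n m) \<longlonglongrightarrow> L n" "L \<longlonglongrightarrow> l"
      using a by (auto simp: iterated_limit_def)
    then show ?thesis
      unfolding iterated_limit_def
      by (intro exI[of _ "\<lambda>n. 1 - L n"] conjI allI impI tendsto_diff tendsto_const)
  qed
  ultimately have "AE \<omega> in M. iterated_limit
      (\<lambda>n m. 1 - midpoint_freq m (Sn n \<omega>) (\<lambda>j. Z n j \<omega>)) (1 - q)"
    by (auto elim: eventually_mono)
  with main show ?thesis
    unfolding q_prob nonconvexity_est_def nonconvexity_def q_pair by (rule conjI[rotated])
qed

end
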